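(* Let $(C,c)\in\mathrm{Sym}_n(\mathbb{R})\times\mathbb{R}^n$ be generic. Then the sign-flipping algorithm described in the context, run on input $(C,c)$, terminates. Moreover, for generic $(C,c)$ there exists at least one $x\in\{-1,+1\}^n$ such that $(C,c)\in P_x$.
   Context: $\mathrm{Sym}_n(\mathbb{R})$ is the space of real symmetric $n\times n$ matrices; $C=(c_{ij})$, $c_{ij}=c_{ji}$, $c=(c_1,\ldots,c_n)^T$. A pair $(C,c)$ is called generic if $x^TCx+2c^Tx\neq y^TCy+2c^Ty$ for all distinct $x,y\in\{-1,+1\}^n$. For $x\in\{-1,+1\}^n$ define the open polyhedral cone $$P_x = \Big\{(C,c)\in\mathrm{Sym}_n(\mathbb{R})\times\mathbb{R}^n : -\frac{1}{x_j}\Big(c_j+\sum_{i\neq j}c_{ij}x_i\Big)>0 \text{ for all } j=1,\ldots,n\Big\}.$$ Algorithm. Input: $(C,c)$. Output: $x\in\{-1,+1\}^n$ with $(C,c)\in P_x$. (1) Fix a starting vector $x\in\{-1,+1\}^n$. (2) If $(C,c)\in P_x$, terminate and return $x$. (3) If $(C,c)\notin P_x$, let $v\in\mathbb{R}^n$ be the vector with entries $v_j=-\frac{1}{x_j}(c_j+\sum_{i\neq j}c_{ij}x_i)$, let $i^*$ be the first index with $v_{i^*}<0$, and let $\hat{x}$ be the vector obtained from $x$ by negating the $i^*$-th coordinate only. (4) Replace $x$ by $\hat{x}$ and return to step (2). *)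

theory Defs
  imports "HOL-Analysis.Analysis"
begin

text \<open>Coordinates are indexed by a finite linearly ordered type \<open>'n\<close>, with \<open>CARD('n)\<close> in the role of
  \<open>n\<close>; the order gives meaning to ``first index''.\<close>

definition Sym :: "(real^'n^'n) set" where
  "Sym = {C. transpose C = C}"

definition signs :: "(real^'n) set" where
  "signs = {x. \<forall>j. x $ j = -1 \<or> x $ j = 1}"

definition generic :: "(real^'n^'n) \<times> (real^'n) \<Rightarrow> bool" where
  "generic = (\<lambda>(C, c). \<forall>x\<in>signs. \<forall>y\<in>signs. x \<noteq> y \<longrightarrow>
     x \<bullet> (C *v x) + 2 * (c \<bullet> x) \<noteq> y \<bullet> (C *v y) + 2 * (c \<bullet> y))"

definition flip_vec :: "(real^'n^'n) \<times> (real^'n) \<Rightarrow> real^'n \<Rightarrow> real^'n" where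
  "flip_vec = (\<lambda>(C, c) x. \<chi> j. - (1 / x $ j) * (c $ j + (\<Sum>i\<in>UNIV - {j}. C $ i $ j * x $ i)))"

definition P_cone :: "real^'n \<Rightarrow> ((real^'n^'n) \<times> (real^'n)) set" where
  "P_cone x = {(C, c) \<in> Sym \<times> UNIV. \<forall>j. flip_vec (C, c) x $ j > 0}"

definition first_negative :: "real^'n::{finite,linorder} \<Rightarrow> 'n::{finite,linorder} \<Rightarrow> bool" where
  "first_negative v i \<longleftrightarrow> v $ i < 0 \<and> (\<forall>j<i. \<not> v $ j < 0)"

definition negate_coord :: "'n \<Rightarrow> real^'n \<Rightarrow> real^'n" where
  "negate_coord i x = (\<chi> j. if j = i then - x $ j else x $ j)"

text \<open>\<open>alg_returns p x y\<close>: on input \<open>p\<close>, the algorithm started (or continued) at step (2) with current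
  vector \<open>x\<close> halts after finitely many steps and returns \<open>y\<close>. A run that loops forever, or that needs
  a first negative entry where there is none, returns nothing.\<close>

inductive alg_returns ::
  "(real^'n::{finite,linorder}^'n::{finite,linorder}) \<times> (real^'n::{finite,linorder}) \<Rightarrow>
     real^'n::{finite,linorder} \<Rightarrow> real^'n::{finite,linorder} \<Rightarrow> bool"
  for p where
  halt: "p \<in> P_cone x \<Longrightarrow> alg_returns p x x"
| flip: "p \<notin> P_cone x \<Longrightarrow> first_negative (flip_vec p x) i \<Longrightarrow>
         alg_returns p (negate_coord i x) y \<Longrightarrow> alg_returns p x y"

definition alg_terminates ::
  "(real^'n::{finite,linorder}^'n::{finite,linorder}) \<times> (real^'n::{finite,linorder}) \<Rightarrow>
     real^'n::{finite,linorder} \<Rightarrow> bool" where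
  "alg_terminates p x \<longleftrightarrow> (\<exists>y. alg_returns p x y)"

end

theory Submission
  imports Defs
begin

text \<open>The algorithm is a descent method for the quadratic function
  \<open>q(x) = x\<^sup>T C x + 2 c\<^sup>T x\<close> on the finite set of sign vectors. Since \<open>x\<^sub>j\<^sup>2 = 1\<close>, the diagonal of \<open>C\<close>
  contributes the same amount to \<open>q\<close> at every sign vector, and negating the coordinate \<open>x\<^sub>j\<close> changes
  \<open>q\<close> by exactly \<open>4 v\<^sub>j\<close>, where \<open>v\<close> is the vector inspected by the algorithm
  (\<open>quad_fun_negate_coord\<close>). Two consequences follow. A step negates a coordinate with
  \<open>v\<^sub>j < 0\<close>, so \<open>q\<close> strictly decreases and no sign vector is visited twice. Genericity says that
  \<open>q\<close> takes different values at \<open>x\<close> and at each of its neighbours, so \<open>v\<close> has no zero entry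
  (\<open>flip_vec_nonzero\<close>): whenever the halting test fails, some entry is negative and a step is
  possible. Hence every run halts, and the vector that it returns is the required one; a starting
  vector exists, for instance the all-ones vector.\<close>

definition quad_fun :: "(real^'n^'n) \<times> (real^'n) \<Rightarrow> real^'n \<Rightarrow> real" where
  "quad_fun = (\<lambda>(C, c) x. x \<bullet> (C *v x) + 2 * (c \<bullet> x))"

lemma finite_signs: "finite (signs :: (real^'n) set)"
proof (rule finite_subset)
  show "(signs :: (real^'n) set) \<subseteq> vec_lambda ` (PiE UNIV (\<lambda>_. {-1, 1}))"
  proof
    fix x :: "real^'n" assume "x \<in> signs"
    then have "vec_nth x \<in> PiE UNIV (\<lambda>_. {-1, 1})"
      by (auto simp: signs_def)
    then show "x \<in> vec_lambda ` (PiE UNIV (\<lambda>_. {-1, 1}))"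
      by (rule rev_image_eqI) simp
  qed
  show "finite (vec_lambda ` (PiE (UNIV :: 'n set) (\<lambda>_. {-1, 1 :: real})))"
    by (intro finite_imageI finite_PiE) auto
qed

lemma negate_coord_in_signs: "x \<in> signs \<Longrightarrow> negate_coord j x \<in> signs"
  by (fastforce simp: signs_def negate_coord_def)

lemma negate_coord_neq:
  assumes "x \<in> signs"
  shows "negate_coord j x \<noteq> x"
proof -
  have "x $ j = -1 \<or> x $ j = 1"
    using assms by (simp add: signs_def)
  then have "negate_coord j x $ j \<noteq> x $ j"
    by (auto simp: negate_coord_def)
  then show ?thesis
    by metis
qed

lemma negate_coord_eq_add_axis: "negate_coord j x = x + (- 2 * x $ j) *\<^sub>R axis j 1"
  by (auto simp: negate_coord_def vec_eq_iff axis_def)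

lemma quad_fun_add_axis:
  fixes C :: "real^'n^'n"
  assumes "C \<in> Sym"
  shows "quad_fun (C, c) (x + t *\<^sub>R axis j 1) =
    quad_fun (C, c) x + 2 * t * (c $ j + (C *v x) $ j) + t\<^sup>2 * C $ j $ j"
proof -
  have sym: "x \<bullet> (C *v axis j 1) = (C *v x) $ j"
  proof -
    have "transpose C = C"
      using assms by (simp add: Sym_def)
    then have "x \<bullet> (C *v axis j 1) = (C *v x) \<bullet> axis j 1"
      using vector_transpose_matrix[of x C] by (simp flip: dot_lmul_matrix)
    then show ?thesis
      by (simp add: inner_axis)
  qed
  have diag: "(C *v axis j 1) $ j = C $ j $ j"
    by (simp add: matrix_vector_mult_basis column_def)
  show ?thesis
    by (simp add: quad_fun_def matrix_vector_right_distrib matrix_vector_mult_scaleR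
        inner_add_left inner_add_right sym diag inner_axis inner_axis' power2_eq_square algebra_simps)
qed

text \<open>With \<open>t = - 2 x\<^sub>j\<close> in the expansion above, \<open>t\<^sup>2 = 4\<close> and the quadratic term cancels the
  diagonal part \<open>2 t C\<^sub>j\<^sub>j x\<^sub>j = - 4 C\<^sub>j\<^sub>j\<close> of the linear one. What remains is the sum over \<open>i \<noteq> j\<close> in
  the definition of \<open>v\<^sub>j\<close>.\<close>

lemma quad_fun_negate_coord:
  fixes C :: "real^'n^'n"
  assumes "C \<in> Sym" and "x \<in> signs"
  shows "quad_fun (C, c) (negate_coord j x) = quad_fun (C, c) x + 4 * flip_vec (C, c) x $ j"
proof -
  define s where "s = (\<Sum>i\<in>UNIV - {j}. C $ i $ j * x $ i)"
  have "C $ j $ i = C $ i $ j" for i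
    using assms(1) by (auto simp: Sym_def transpose_def vec_eq_iff)
  then have "s = (\<Sum>i\<in>UNIV - {j}. C $ j $ i * x $ i)"
    unfolding s_def by (intro sum.cong) simp_all
  moreover have "(C *v x) $ j = C $ j $ j * x $ j + (\<Sum>i\<in>UNIV - {j}. C $ j $ i * x $ i)"
    unfolding matrix_vector_mult_def vec_lambda_beta by (rule sum.remove) simp_all
  ultimately have row: "(C *v x) $ j = C $ j $ j * x $ j + s"
    by simp
  have v: "flip_vec (C, c) x $ j = - (1 / x $ j) * (c $ j + s)"
    by (simp add: flip_vec_def s_def)
  have "x $ j = -1 \<or> x $ j = 1"
    using assms(2) by (simp add: signs_def)
  then show ?thesis
    unfolding negate_coord_eq_add_axis quad_fun_add_axis[OF assms(1)] row v
    by (auto simp: power2_eq_square)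
qed

lemma flip_vec_nonzero:
  fixes C :: "real^'n^'n"
  assumes "C \<in> Sym" and "generic (C, c)" and "x \<in> signs"
  shows "flip_vec (C, c) x $ j \<noteq> 0"
proof -
  have "quad_fun (C, c) (negate_coord j x) \<noteq> quad_fun (C, c) x"
    using assms(2,3) negate_coord_in_signs[OF assms(3)] negate_coord_neq[OF assms(3)]
    by (simp add: generic_def quad_fun_def)
  then show ?thesis
    using quad_fun_negate_coord[OF assms(1,3), of c j] by simp
qed

lemma first_negative_exists:
  fixes v :: "real^'n::{finite,linorder}"
  assumes "v $ j < 0"
  shows "\<exists>i. first_negative v i"
proof -
  define i where "i = Min {k. v $ k < 0}"
  have "i \<in> {k. v $ k < 0}"
    unfolding i_def using assms by (intro Min_in) auto
  moreover have "\<not> v $ k < 0" if "k < i" for k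
    using that unfolding i_def by (metis finite mem_Collect_eq Min_le not_le)
  ultimately show ?thesis
    unfolding first_negative_def by blast
qed

text \<open>The number of sign vectors at which \<open>q\<close> is smaller than at the current vector drops with each
  step, which turns the descent of \<open>q\<close> into an induction.\<close>

lemma alg_terminates_generic:
  fixes C :: "real^'n::{finite,linorder}^'n::{finite,linorder}"
  assumes "C \<in> Sym" and "generic (C, c)" and "x \<in> signs"
  shows "alg_terminates (C, c) x"
  using assms(3)
proof (induction "card {y \<in> signs. quad_fun (C, c) y < quad_fun (C, c) x}"
    arbitrary: x rule: less_induct)
  case less
  show ?case
  proof (cases "(C, c) \<in> P_cone x")
    case True
    then show ?thesis
      unfolding alg_terminates_def by (blast intro: alg_returns.halt)
  next
    case False
    then obtain j where "\<not> flip_vec (C, c) x $ j > 0"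
      using assms(1) by (auto simp: P_cone_def)
    then have "flip_vec (C, c) x $ j < 0"
      using flip_vec_nonzero[OF assms(1,2) less.prems, of j] by simp
    then obtain i where i: "first_negative (flip_vec (C, c) x) i"
      using first_negative_exists by blast
    let ?x' = "negate_coord i x"
    have x': "?x' \<in> signs"
      using less.prems by (rule negate_coord_in_signs)
    have desc: "quad_fun (C, c) ?x' < quad_fun (C, c) x"
      using i quad_fun_negate_coord[OF assms(1) less.prems, of c i]
      by (simp add: first_negative_def)
    then have "{y \<in> signs. quad_fun (C, c) y < quad_fun (C, c) ?x'}
        \<subseteq> {y \<in> signs. quad_fun (C, c) y < quad_fun (C, c) x}"
      by auto
    moreover have "?x' \<in> {y \<in> signs. quad_fun (C, c) y < quad_fun (C, c) x}"
      using x' desc by simp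
    ultimately have "{y \<in> signs. quad_fun (C, c) y < quad_fun (C, c) ?x'}
        \<subset> {y \<in> signs. quad_fun (C, c) y < quad_fun (C, c) x}"
      by blast
    then have "card {y \<in> signs. quad_fun (C, c) y < quad_fun (C, c) ?x'}
        < card {y \<in> signs. quad_fun (C, c) y < quad_fun (C, c) x}"
      by (intro psubset_card_mono) (simp_all add: finite_signs)
    then have "alg_terminates (C, c) ?x'"
      using x' by (rule less.hyps)
    then show ?thesis
      unfolding alg_terminates_def by (blast intro: alg_returns.flip[OF False i])
  qed
qed

lemma alg_returns_correct:
  assumes "alg_returns p x y" and "x \<in> signs"
  shows "y \<in> signs \<and> p \<in> P_cone y"
  using assms by induction (simp_all add: negate_coord_in_signs)

theorem theorem4p7:
  fixes C :: "real^'n::{finite,linorder}^'n::{finite,linorder}" and c :: "real^'n::{finite,linorder}"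
  assumes "(C, c) \<in> Sym \<times> UNIV"
    and "generic (C, c)"
  shows "(\<forall>x\<in>signs. alg_terminates (C, c) x) \<and> (\<exists>x\<in>signs. (C, c) \<in> P_cone x)"
proof
  show halts: "\<forall>x\<in>signs. alg_terminates (C, c) x"
    using assms alg_terminates_generic by blast
  have "(\<chi> j. 1) \<in> (signs :: (real^'n::{finite,linorder}) set)"
    by (simp add: signs_def)
  then show "\<exists>x\<in>signs. (C, c) \<in> P_cone x"
    using halts alg_returns_correct unfolding alg_terminates_def by blast
qed

end
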